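(* Let $\mathcal{M}=\{A_1,\dots,A_m\}\subset\mathbb{R}^{n\times n}$ be a finite set of nonsingular matrices, and consider the projected switched system on $\mathbb{P}^{n-1}$ $$z(k+1)=\frac{A_{\sigma_k}z(k)}{|A_{\sigma_k}z(k)|},\qquad A_{\sigma_k}\in\mathcal{M},$$ with attainable sets $O^+(\cdot)$ and $O^-(\cdot)$ in positive and negative time. Assume that there exist two points $z^{(1)},z^{(2)}\in\mathbb{P}^{n-1}$ such that $\tilde\rho_{z^{(1)}}(\mathcal{M})<\tilde\rho_{z^{(2)}}(\mathcal{M})$. Then the function $x\mapsto\tilde\rho_x(\mathcal{M})$ on $\mathbb{R}^n$ is discontinuous at every point of the cone $$D=\big\{\lambda z : \lambda>0,\ z\in\mathrm{clos}(O^-(z^{(1)}))\cap\mathrm{clos}(O^+(z^{(2)}))\big\}\subset\mathbb{R}^n.$$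
   Context: Given a finite set $\mathcal{M}=\{A_1,\dots,A_m\}\subset\mathbb{R}^{n\times n}$, a solution of the switched system starting at $x_0\in\mathbb{R}^n$ is a sequence $(x(k))_{k\ge 0}$ with $x(0)=x_0$ and $x(k+1)=A_{\sigma_k}x(k)$ for all $k\ge 0$, for some switching signal $\sigma:\mathbb{N}\to\{1,\dots,m\}$ (which may depend on $x_0$). Let $|\cdot|$ be the Euclidean norm. For $x_0\in\mathbb{R}^n$ define $$\tilde\rho_{x_0}(\mathcal{M})=\inf\{\lambda\ge 0 : \exists\text{ a solution } x(\cdot)\text{ starting at }x_0\text{ and } M>0 \text{ such that } |x(k)|\le M\lambda^k|x_0|\ \forall k\ge 0\}.$$ A point of the projective space $\mathbb{P}^{n-1}$ is identified with a pair of opposite points $z,-z$ of the unit sphere $S^{n-1}\subset\mathbb{R}^n$; since $\tilde\rho_{z}(\mathcal{M})=\tilde\rho_{-z}(\mathcal{M})$, the value $\tilde\rho_z(\mathcal{M})$ is well defined for $z\in\mathbb{P}^{n-1}$, and a subset of $\mathbb{P}^{n-1}$ is viewed as a subset of $S^{n-1}$ symmetric under $z\mapsto -z$. For $k\ge 0$, $\mathcal{M}^k$ is the set of products of $k$ matrices of $\mathcal{M}$ ($\mathcal{M}^0=\{I\}$). The attainable sets from $z\in\mathbb{P}^{n-1}$ in positive and negative time are $$O^+(z)=\Big\{\tfrac{Bz}{|Bz|} : B\in\mathcal{M}^k,\ k\ge 0\Big\},\qquad O^-(z)=\Big\{\tfrac{B^{-1}z}{|B^{-1}z|} : B\in\mathcal{M}^k,\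 k\ge 0\Big\}.$$ $\mathrm{clos}$ denotes topological closure. *)

theory Defs
  imports "HOL-Analysis.Analysis"
begin

definition switched_solution ::
    "(real^'n^'n) set \<Rightarrow> real^'n \<Rightarrow> (nat \<Rightarrow> real^'n) \<Rightarrow> bool" where
  "switched_solution M x0 x \<longleftrightarrow>
     x 0 = x0 \<and>
     (\<exists>\<sigma> :: nat \<Rightarrow> real^'n^'n. (\<forall>k. \<sigma> k \<in> M) \<and> (\<forall>k. x (Suc k) = \<sigma> k *v x k))"

text \<open>If \<open>M\<close> is nonempty and finite, the set below is nonempty and bounded below by \<open>0\<close>, so
  the infimum is the true one.\<close>

definition pointwise_rate :: "(real^'n^'n) set \<Rightarrow> real^'n \<Rightarrow> real" where
  "pointwise_rate M x0 =
     Inf {l. l \<ge> 0 \<and> (\<exists>x C. switched_solution M x0 x \<and> C > 0 \<and>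
                          (\<forall>k. norm (x k) \<le> C * l ^ k * norm x0))}"

fun matrix_products :: "(real^'n^'n) set \<Rightarrow> nat \<Rightarrow> (real^'n^'n) set" where
  "matrix_products M 0 = {mat 1}"
| "matrix_products M (Suc k) = {A ** B | A B. A \<in> M \<and> B \<in> matrix_products M k}"

text \<open>A point of projective space is a pair \<open>{z, -z}\<close> of opposite unit vectors, represented by
  either of them; a set of such points is the corresponding subset of the unit sphere, symmetric
  under negation. Hence the attainable sets start from both \<open>z\<close> and \<open>-z\<close>. Because the sphere is
  closed and antipodally symmetric sets have antipodally symmetric closures, the closure in
  \<open>real^'n\<close> of such a set represents its closure in projective space.\<close>

definition attainable_pos :: "(real^'n^'n) set \<Rightarrow> real^'n \<Rightarrow> (real^'n) set" where
  "attainable_pos M z =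
     {(B *v v) /\<^sub>R norm (B *v v) | B v k. B \<in> matrix_products M k \<and> v \<in> {z, - z}}"

definition attainable_neg :: "(real^'n^'n) set \<Rightarrow> real^'n \<Rightarrow> (real^'n) set" where
  "attainable_neg M z =
     {(matrix_inv B *v v) /\<^sub>R norm (matrix_inv B *v v) | B v k.
        B \<in> matrix_products M k \<and> v \<in> {z, - z}}"

text \<open>None of these notions depends on the choice of representative.\<close>

lemma switched_solution_minus:
  assumes "switched_solution M x0 x"
  shows "switched_solution M (- x0) (\<lambda>k. - x k)"
proof -
  have "A *v (- v) = - (A *v v)" for A :: "real^'n^'n" and v
    using matrix_vector_mult_scaleR[of A "-1" v] by simp
  then show ?thesis
    using assms unfolding switched_solution_def by metis
qed

lemma pointwise_rate_minus: "pointwise_rate M (- x0) = pointwise_rate M x0"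
proof -
  have *: "\<exists>x C. switched_solution M (- y) x \<and> C > 0 \<and>
              (\<forall>k. norm (x k) \<le> C * l ^ k * norm (- y))"
    if "\<exists>x C. switched_solution M y x \<and> C > 0 \<and> (\<forall>k. norm (x k) \<le> C * l ^ k * norm y)"
    for y l
  proof -
    from that obtain x C where "switched_solution M y x" "C > 0"
      "\<forall>k. norm (x k) \<le> C * l ^ k * norm y" by blast
    then show ?thesis
      by (intro exI[of _ "\<lambda>k. - x k"] exI[of _ C]) (simp add: switched_solution_minus)
  qed
  have "(\<exists>x C. switched_solution M (- x0) x \<and> C > 0 \<and>
              (\<forall>k. norm (x k) \<le> C * l ^ k * norm (- x0))) \<longleftrightarrow>
        (\<exists>x C. switched_solution M x0 x \<and> C > 0 \<and>
              (\<forall>k. norm (x k) \<le> C * l ^ k * norm x0))" for l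
    using *[of "- x0" l] *[of x0 l] unfolding minus_minus by iprover
  then show ?thesis
    unfolding pointwise_rate_def by presburger
qed

lemma attainable_minus:
  "attainable_pos M (- z) = attainable_pos M z"
  "attainable_neg M (- z) = attainable_neg M z"
  unfolding attainable_pos_def attainable_neg_def by (simp_all add: insert_commute)

definition discontinuity_cone ::
    "(real^'n^'n) set \<Rightarrow> real^'n \<Rightarrow> real^'n \<Rightarrow> (real^'n) set" where
  "discontinuity_cone M z1 z2 =
     {l *\<^sub>R z | l z. l > 0 \<and> z \<in> closure (attainable_neg M z1) \<inter> closure (attainable_pos M z2)}"

end

theory Submission
  imports Defs
begin

text \<open>
  The rate is monotone along the switched system: any solution from \<open>A *v x\<close> can be prolonged
  backwards by the one step \<open>x \<mapsto> A *v x\<close>, and a single extra step only changes the constant in an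
  exponential bound, not the exponent. Hence \<open>pointwise_rate M x \<le> pointwise_rate M (B *v x)\<close> for
  every product \<open>B\<close> of matrices of \<open>M\<close> (\<open>pointwise_rate_le_matrix_product\<close>). As the rate is also
  constant on punctured lines (\<open>pointwise_rate_scaleR\<close>), it is at most the rate of \<open>z1\<close> on the
  negative attainable set of \<open>z1\<close>, and at least the rate of \<open>z2\<close> on the positive attainable set of
  \<open>z2\<close>. At a common limit point of these two sets, continuity would carry both bounds to the limit
  and force \<open>pointwise_rate M z2 \<le> pointwise_rate M z1\<close>.
\<close>

definition growth_bounds :: "(real^'n^'n) set \<Rightarrow> real^'n \<Rightarrow> real set" where
  "growth_bounds M x0 =
     {l. l \<ge> 0 \<and> (\<exists>x C. switched_solution M x0 x \<and> C > 0 \<and>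
                          (\<forall>k. norm (x k) \<le> C * l ^ k * norm x0))}"

lemma pointwise_rate_eq_Inf: "pointwise_rate M x = Inf (growth_bounds M x)"
  unfolding pointwise_rate_def growth_bounds_def ..

lemma growth_boundsI:
  assumes "l \<ge> 0" "switched_solution M x0 x" "C > 0" "\<And>k. norm (x k) \<le> C * l ^ k * norm x0"
  shows "l \<in> growth_bounds M x0"
  using assms unfolding growth_bounds_def by blast

lemma growth_boundsE:
  assumes "l \<in> growth_bounds M x0"
  obtains x C where "l \<ge> 0" "switched_solution M x0 x" "C > 0"
    "\<And>k. norm (x k) \<le> C * l ^ k * norm x0"
  using assms unfolding growth_bounds_def by blast

lemma bdd_below_growth_bounds: "bdd_below (growth_bounds M x)"
  by (rule bdd_belowI[of _ 0]) (auto simp: growth_bounds_def)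

lemma growth_bounds_scaleR_subset:
  "growth_bounds M x \<subseteq> growth_bounds M (c *\<^sub>R x)"
proof
  fix l assume "l \<in> growth_bounds M x"
  then obtain y C where y: "l \<ge> 0" "switched_solution M x y" "C > 0"
    and bound: "\<And>k. norm (y k) \<le> C * l ^ k * norm x"
    by (rule growth_boundsE) blast
  show "l \<in> growth_bounds M (c *\<^sub>R x)"
  proof (rule growth_boundsI[OF y(1) _ y(3)])
    show "switched_solution M (c *\<^sub>R x) (\<lambda>k. c *\<^sub>R y k)"
      using y(2) unfolding switched_solution_def by (auto simp: matrix_vector_mult_scaleR)
    show "norm (c *\<^sub>R y k) \<le> C * l ^ k * norm (c *\<^sub>R x)" for k
      using mult_left_mono[OF bound[of k], of "\<bar>c\<bar>"] by (simp add: mult_ac)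
  qed
qed

lemma pointwise_rate_scaleR:
  assumes "c \<noteq> 0"
  shows "pointwise_rate M (c *\<^sub>R x) = pointwise_rate M x"
proof -
  have "growth_bounds M (c *\<^sub>R x) \<subseteq> growth_bounds M x"
    using growth_bounds_scaleR_subset[of M "c *\<^sub>R x" "inverse c"] assms by simp
  then show ?thesis
    unfolding pointwise_rate_eq_Inf using growth_bounds_scaleR_subset[of M x c] by (simp add: subset_antisym)
qed

text \<open>Applying one fixed matrix of \<open>M\<close> forever already gives an exponentially bounded solution, so
  the infimum defining the rate is taken over a nonempty set.\<close>

lemma growth_bounds_nonempty:
  assumes "M \<noteq> {}"
  shows "growth_bounds M x \<noteq> {}"
proof -
  obtain A where A: "A \<in> M" using assms by blast
  let ?y = "\<lambda>k. (((*v) A) ^^ k) x"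
  have "norm (?y k) \<le> onorm ((*v) A) ^ k * norm x" for k
  proof (induction k)
    case (Suc k)
    have "norm (?y (Suc k)) \<le> onorm ((*v) A) * norm (?y k)"
      using onorm[OF matrix_vector_mul_bounded_linear[of A]] by simp
    also have "\<dots> \<le> onorm ((*v) A) * (onorm ((*v) A) ^ k * norm x)"
      by (intro mult_left_mono Suc.IH onorm_pos_le matrix_vector_mul_bounded_linear)
    finally show ?case by (simp add: mult_ac)
  qed simp
  moreover have "switched_solution M x ?y"
    unfolding switched_solution_def using A by (auto intro!: exI[of _ "\<lambda>_. A"])
  ultimately have "onorm ((*v) A) \<in> growth_bounds M x"
    by (intro growth_boundsI[of _ _ _ ?y 1]) (auto intro: onorm_pos_le)
  then show ?thesis by blast
qed

lemma invertible_mult_eq_0_iff: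
  fixes A :: "real^'n^'n"
  assumes "invertible A"
  shows "A *v x = 0 \<longleftrightarrow> x = 0"
  using matrix_left_invertible_ker[of A] assms by (auto simp: invertible_def)

text \<open>With nonsingular matrices, the exponent \<open>0\<close> could only bound a solution that vanishes from
  the first step on. Exponents are therefore positive, which allows a shift in time to be absorbed
  in the constant.\<close>

lemma growth_bounds_pos:
  assumes inv: "\<And>A. A \<in> M \<Longrightarrow> invertible A" and "x \<noteq> 0" and "l \<in> growth_bounds M x"
  shows "l > 0"
proof -
  obtain y C where y: "l \<ge> 0" "switched_solution M x y"
    and bound: "\<And>k. norm (y k) \<le> C * l ^ k * norm x"
    using assms(3) by (rule growth_boundsE) blast
  have "y (Suc 0) \<noteq> 0"
    using y(2) inv \<open>x \<noteq> 0\<close> invertible_mult_eq_0_iff unfolding switched_solution_def by metis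
  then have "l \<noteq> 0" using bound[of 1] by auto
  then show ?thesis using y(1) by simp
qed

lemma switched_solution_case_nat:
  assumes "A \<in> M" and "switched_solution M (A *v x) y"
  shows "switched_solution M x (case_nat x y)"
proof -
  from assms(2) obtain \<sigma> where "y 0 = A *v x" "\<And>k. \<sigma> k \<in> M" "\<And>k. y (Suc k) = \<sigma> k *v y k"
    unfolding switched_solution_def by blast
  then show ?thesis
    unfolding switched_solution_def using assms(1)
    by (intro conjI exI[of _ "case_nat A \<sigma>"]) (auto split: nat.split)
qed

lemma growth_bounds_mult_subset:
  assumes inv: "\<And>A. A \<in> M \<Longrightarrow> invertible A" and "A \<in> M" and "x \<noteq> 0"
  shows "growth_bounds M (A *v x) \<subseteq> growth_bounds M x"
proof
  fix l assume l: "l \<in> growth_bounds M (A *v x)"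
  have "A *v x \<noteq> 0" using assms invertible_mult_eq_0_iff by blast
  then have "l > 0" using growth_bounds_pos[OF inv _ l] by blast
  obtain y C where y: "switched_solution M (A *v x) y" "C > 0"
    and bound: "\<And>k. norm (y k) \<le> C * l ^ k * norm (A *v x)"
    using l by (rule growth_boundsE) blast
  \<comment> \<open>The first entry of \<open>max\<close> covers time \<open>0\<close>; the second absorbs the shift
      \<open>l ^ k = l ^ Suc k / l\<close> and the change of initial point at all later times.\<close>
  define C' where "C' = max 1 (C * norm (A *v x) / (l * norm x))"
  show "l \<in> growth_bounds M x"
  proof (rule growth_boundsI[where C = C'])
    show "switched_solution M x (case_nat x y)"
      using switched_solution_case_nat[OF \<open>A \<in> M\<close> y(1)] .
    show "norm (case k of 0 \<Rightarrow> x | Suc j \<Rightarrow> y j) \<le> C' * l ^ k * norm x" for k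
    proof (cases k)
      case 0
      have "1 * norm x \<le> C' * norm x"
        by (intro mult_right_mono) (auto simp: C'_def)
      then show ?thesis using 0 by simp
    next
      case (Suc j)
      have "norm (y j) \<le> (C * norm (A *v x) / (l * norm x)) * (l ^ Suc j * norm x)"
        using bound[of j] \<open>l > 0\<close> \<open>x \<noteq> 0\<close> by (simp add: field_simps)
      also have "\<dots> \<le> C' * (l ^ Suc j * norm x)"
        using \<open>l > 0\<close> by (intro mult_right_mono) (auto simp: C'_def)
      finally show ?thesis using Suc by (simp add: mult_ac)
    qed
  qed (use \<open>l > 0\<close> in \<open>auto simp: C'_def\<close>)
qed

lemma invertible_matrix_product:
  assumes "\<And>A. A \<in> M \<Longrightarrow> invertible A" and "B \<in> matrix_products M k"
  shows "invertible B"
  using assms(2)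
  by (induction k arbitrary: B) (auto intro: invertible_mult assms(1) simp: invertible_def[of "mat 1"])

lemma pointwise_rate_le_matrix_product:
  assumes inv: "\<And>A. A \<in> M \<Longrightarrow> invertible A" and "B \<in> matrix_products M k" and "x \<noteq> 0"
  shows "pointwise_rate M x \<le> pointwise_rate M (B *v x)"
  using assms(2)
proof (induction k arbitrary: B)
  case (Suc k)
  then obtain A B' where A: "A \<in> M" and B': "B' \<in> matrix_products M k" and B: "B = A ** B'"
    by auto
  have "B' *v x \<noteq> 0"
    using invertible_matrix_product[OF inv B'] invertible_mult_eq_0_iff \<open>x \<noteq> 0\<close> by blast
  then have "growth_bounds M (A *v (B' *v x)) \<subseteq> growth_bounds M (B' *v x)"
    by (intro growth_bounds_mult_subset inv A)
  moreover have "growth_bounds M (A *v (B' *v x)) \<noteq> {}"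
    using A by (intro growth_bounds_nonempty) blast
  ultimately have "pointwise_rate M (B' *v x) \<le> pointwise_rate M (A *v (B' *v x))"
    unfolding pointwise_rate_eq_Inf by (intro cInf_superset_mono bdd_below_growth_bounds)
  then show ?case
    using Suc.IH[OF B'] by (simp add: B matrix_vector_mul_assoc)
qed simp

lemma pointwise_rate_attainable_pos:
  assumes inv: "\<And>A. A \<in> M \<Longrightarrow> invertible A" and "z \<noteq> 0" and "y \<in> attainable_pos M z"
  shows "pointwise_rate M z \<le> pointwise_rate M y"
proof -
  from assms(3) obtain B v k where B: "B \<in> matrix_products M k" and v: "v \<in> {z, - z}"
    and y: "y = (B *v v) /\<^sub>R norm (B *v v)"
    unfolding attainable_pos_def by blast
  have "v \<noteq> 0" using v \<open>z \<noteq> 0\<close> by auto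
  then have "B *v v \<noteq> 0"
    using invertible_matrix_product[OF inv B] invertible_mult_eq_0_iff by blast
  then have "pointwise_rate M y = pointwise_rate M (B *v v)"
    unfolding y by (intro pointwise_rate_scaleR) simp
  moreover have "pointwise_rate M v = pointwise_rate M z"
    using v by (auto simp: pointwise_rate_minus)
  ultimately show ?thesis
    using pointwise_rate_le_matrix_product[OF inv B \<open>v \<noteq> 0\<close>] by simp
qed

lemma mult_matrix_inv:
  fixes A :: "real^'n^'n"
  assumes "invertible A"
  shows "A ** matrix_inv A = mat 1"
  using assms unfolding invertible_def matrix_inv_def by (rule someI2_ex) blast

lemma pointwise_rate_attainable_neg:
  assumes inv: "\<And>A. A \<in> M \<Longrightarrow> invertible A" and "z \<noteq> 0" and "y \<in> attainable_neg M z"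
  shows "pointwise_rate M y \<le> pointwise_rate M z"
proof -
  from assms(3) obtain B v k where B: "B \<in> matrix_products M k" and v: "v \<in> {z, - z}"
    and y: "y = (matrix_inv B *v v) /\<^sub>R norm (matrix_inv B *v v)"
    unfolding attainable_neg_def by blast
  let ?w = "matrix_inv B *v v"
  have "B *v ?w = v"
    using mult_matrix_inv[OF invertible_matrix_product[OF inv B]]
    by (simp add: matrix_vector_mul_assoc)
  moreover have "v \<noteq> 0" using v \<open>z \<noteq> 0\<close> by auto
  ultimately have "?w \<noteq> 0" by auto
  then have "pointwise_rate M y = pointwise_rate M ?w"
    unfolding y by (intro pointwise_rate_scaleR) simp
  moreover have "pointwise_rate M v = pointwise_rate M z"
    using v by (auto simp: pointwise_rate_minus)
  ultimately show ?thesis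
    using pointwise_rate_le_matrix_product[OF inv B \<open>?w \<noteq> 0\<close>] \<open>B *v ?w = v\<close> by simp
qed

lemma isCont_closure_le:
  fixes f :: "'a::metric_space \<Rightarrow> real"
  assumes "isCont f x" and "x \<in> closure S" and "\<And>y. y \<in> S \<Longrightarrow> f y \<le> c"
  shows "f x \<le> c"
proof -
  from assms(2) obtain s where s: "\<And>n. s n \<in> S" "s \<longlonglongrightarrow> x"
    unfolding closure_sequential by blast
  show ?thesis
    using isCont_tendsto_compose[OF assms(1) s(2)] assms(3) s(1)
    by (intro LIMSEQ_le_const2) auto
qed

theorem proposition2:
  fixes M :: "(real^'n^'n) set" and z1 z2 :: "real^'n"
  assumes "finite M"
    and "\<And>A. A \<in> M \<Longrightarrow> invertible A"
    and "z1 \<in> sphere 0 1" and "z2 \<in> sphere 0 1"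
    and "pointwise_rate M z1 < pointwise_rate M z2"
  shows "\<forall>x \<in> discontinuity_cone M z1 z2. \<not> isCont (pointwise_rate M) x"
proof (intro ballI notI)
  fix x assume "x \<in> discontinuity_cone M z1 z2" and cont: "isCont (pointwise_rate M) x"
  then obtain l z where x: "x = l *\<^sub>R z" and "l > 0"
    and z: "z \<in> closure (attainable_neg M z1)" "z \<in> closure (attainable_pos M z2)"
    unfolding discontinuity_cone_def by blast
  have nz: "z1 \<noteq> 0" "z2 \<noteq> 0" using assms(3,4) by auto
  \<comment> \<open>The closures live on the unit sphere, so continuity is moved from \<open>l *\<^sub>R z\<close> to \<open>z\<close>.\<close>
  have "isCont (\<lambda>y. pointwise_rate M (l *\<^sub>R y)) z"
    using isCont_scaleR[OF continuous_const continuous_ident] cont unfolding x by (rule isCont_o2)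
  then have cont_z: "isCont (pointwise_rate M) z"
    using \<open>l > 0\<close> by (simp add: pointwise_rate_scaleR)
  have "pointwise_rate M z \<le> pointwise_rate M z1"
    using pointwise_rate_attainable_neg[OF assms(2) nz(1)]
    by (rule isCont_closure_le[OF cont_z z(1)])
  moreover have "- pointwise_rate M z \<le> - pointwise_rate M z2"
  proof (rule isCont_closure_le[OF _ z(2)])
    show "isCont (\<lambda>y. - pointwise_rate M y) z" using cont_z by (rule isCont_minus)
    show "- pointwise_rate M y \<le> - pointwise_rate M z2" if "y \<in> attainable_pos M z2" for y
      using pointwise_rate_attainable_pos[OF assms(2) nz(2) that] by simp
  qed
  ultimately show False using assms(5) by simp
qed

end
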